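(* Let $(X_0,X_1)_X$ be a pair of compatible metric spaces with metrics $d_{X_0},d_{X_1},d_X$, let $\theta\in(0,1)$, $q\in[1,\infty]$, and let $(F,d_F)$ be a complete metric space. Suppose $T:X\to F$ is an operator such that (i) $T:X\to F$ is closed; (ii) the restriction $T:X_0\to F$ is a compact Lipschitz operator (with respect to $d_{X_0}$); (iii) the restriction $T:X_1\to F$ is Lipschitz (with respect to $d_{X_1}$); (iv) every sequence in $X_0\cap X_1$ that is bounded with respect to the interpolated metric $\Delta_{\theta,q}$ is also bounded with respect to the metric $d_{X_0}$. Then $T_{\theta,q}:=T|_{R_{\theta,q}^{\overrightarrow{X}}}:R_{\theta,q}^{\overrightarrow{X}}\to F$ is Lipschitz and compact (with respect to $\Delta_{\theta,q}$ and $d_F$).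
   Context: Closed operator: $T:X\to F$ between metric spaces is closed if $d_X(x_n,x)\to0$ and $d_F(T(x_n),y)\to0$ imply $y=T(x)$. Compact operator: a map $T$ between metric spaces such that every bounded sequence $(x_n)$ in the domain has a subsequence $(x_{n_k})$ with $(T(x_{n_k}))$ convergent in the target. Compatible pair: $X_0,X_1\subseteq X$ with $X_0\cap X_1\neq\emptyset$, and $d_0,d_1,d_X$ are metrics on $X_0,X_1,X$ (here $d_i=d_{X_i}$) such that for some constants $C_0,C_1>0$ one has $d_X(x,y)\le C_i\,d_i(x,y)$ for all $x,y\in X_i$, $i\in\{0,1\}$. This is denoted $(X_0,X_1)_X$ or $\overrightarrow{X}$. For $t>0$ and $(x,y)\in X_0^2\cup X_1^2$, the hop functional is $h_t(x,y)=\min\{d_0(x,y),t\,d_1(x,y)\}$ if $x,y\in X_0\cap X_1$; $h_t(x,y)=d_0(x,y)$ if $x,y\in X_0$ are not both in $X_1$; $h_t(x,y)=t\,d_1(x,y)$ if $x,y\in X_1$ are not both in $X_0$. An admissible linking sequence from $x$ to $y$ is a finite sequence $x_0=x,x_1,\dots,x_n=y$ in $X_0\cup X_1$ with $(x_k,x_{k+1})\in X_0^2\cup X_1^2$ for every $k$. Define $K_M(t;x,y)=\inf\sum_{k=0}^{n-1}h_t(x_k,x_{k+1})$ over all admissible linking sequences from $x$ to $y$; it is a metric on $X_0\cup X_1$, denoted $K_M(t)$. For $x,y\in X_0\cap X_1$ define $J_M(t;x,y)=\max\{d_0(x,y),t\,d_1(x,y)\}$, a metric on $X_0\cap X_1$,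 denoted $J_M(t)$. For a real sequence $(a_k)_{k\in\mathbb Z}$, $\Gamma_{\theta,q}((a_k))=\big[\sum_{k\in\mathbb Z}(2^{-k\theta}|a_k|)^q\big]^{1/q}$ if $q<\infty$ and $\Gamma_{\theta,\infty}((a_k))=\sup_{k\in\mathbb Z}2^{-k\theta}|a_k|$ (values in $[0,\infty]$). An approximating sequence of $x\in X_0\cap X_1$ in $(X_0\cap X_1,J_M(1))$ is a sequence $(x_n)_{n\ge0}$ in $X_0\cap X_1$ that is Cauchy for $J_M(1)$ and satisfies $K_M(1;x_n,x)\to0$. Given approximating sequences $(x_n)$ of $x$ and $(y_n)$ of $y$, define $S^{x,y}_k=x_k$ for $k\ge0$ and $S^{x,y}_k=y_{-k}$ for $k<0$. Then $p_{\theta,q}(x,y)=\inf\Gamma_{\theta,q}\big((J_M(2^k;S^{x,y}_k,S^{x,y}_{k+1}))_{k\in\mathbb Z}\big)$, the infimum being over all approximating sequences $(x_n)$ of $x$ and $(y_n)$ of $y$. Further, $P_{\theta,q}(x,y)=\tfrac12(p_{\theta,q}(x,y)+p_{\theta,q}(y,x))$ and $\delta_{\theta,q}(x,y)=\inf\sum_{j=0}^{n-1}P_{\theta,q}(x_j,x_{j+1})$ over all finite sequences $x_0=x,\dots,x_n=y$ in $X_0\cap X_1$; $\delta_{\theta,q}$ is a metric on $X_0\cap X_1$ and $K_M(1;x,y)\le c\,\delta_{\theta,q}(x,y)$ on $X_0\cap X_1$ for some $c>0$. Relative completion: if $(A,d_A)$, $(B,d_B)$ are metric spaces with $A\subseteq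 B$ and $d_B\le c\,d_A$ on $A$ for some $c>0$, the relative completion $A_B$ of $(A,d_A)$ in $(B,d_B)$ is the set of $x\in B$ for which there is a Cauchy sequence $(x_n)$ in $(A,d_A)$ with $d_B(x_n,x)\to0$. It carries a metric $d_{A,B}$ (taken as known) such that $d_{A,B}=d_A$ on $A$, $d_B\le c\,d_{A,B}$ on $A_B$, $A$ is dense in $(A_B,d_{A,B})$, and $(A_B,d_{A,B})$ is complete if $(B,d_B)$ is complete. The $R$-interpolated space $R_{\theta,q}^{\overrightarrow{X}}$ is the relative completion of $(X_0\cap X_1,\delta_{\theta,q})$ in $(X_0\cup X_1,K_M(1))$; its metric $d_{A,B}$ is denoted $\Delta_{\theta,q}$ (the interpolated metric; it equals $\delta_{\theta,q}$ on $X_0\cap X_1$). *)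

theory Defs
  imports "HOL-Analysis.Analysis"
begin

section \<open>Operators between metric spaces\<close>

definition closed_operator :: "'a metric \<Rightarrow> 'b metric \<Rightarrow> ('a \<Rightarrow> 'b) \<Rightarrow> bool"
  where "closed_operator m1 m2 T \<longleftrightarrow>
    T \<in> mspace m1 \<rightarrow> mspace m2 \<and>
    (\<forall>\<sigma> x y. range \<sigma> \<subseteq> mspace m1 \<longrightarrow>
       limitin (mtopology_of m1) \<sigma> x sequentially \<longrightarrow>
       limitin (mtopology_of m2) (T \<circ> \<sigma>) y sequentially \<longrightarrow> y = T x)"

abbreviation mbounded_of :: "'a metric \<Rightarrow> 'a set \<Rightarrow> bool"
  where "mbounded_of m \<equiv> Metric_space.mbounded (mspace m) (mdist m)"

definition compact_operator :: "'a metric \<Rightarrow> 'b metric \<Rightarrow> ('a \<Rightarrow> 'b) \<Rightarrow> bool"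
  where "compact_operator m1 m2 T \<longleftrightarrow>
    T \<in> mspace m1 \<rightarrow> mspace m2 \<and>
    (\<forall>\<sigma>. range \<sigma> \<subseteq> mspace m1 \<and> mbounded_of m1 (range \<sigma>) \<longrightarrow>
       (\<exists>r l. strict_mono (r :: nat \<Rightarrow> nat) \<and>
              limitin (mtopology_of m2) (T \<circ> \<sigma> \<circ> r) l sequentially))"

section \<open>Compatible pairs and the \<open>K\<close>- and \<open>J\<close>-functionals\<close>

definition compatible_pair :: "'a metric \<Rightarrow> 'a metric \<Rightarrow> 'a metric \<Rightarrow> bool"
  where "compatible_pair X X0 X1 \<longleftrightarrow>
    mspace X0 \<subseteq> mspace X \<and> mspace X1 \<subseteq> mspace X \<and>
    mspace X0 \<inter> mspace X1 \<noteq> {} \<and>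
    (\<exists>C0>0. \<forall>x\<in>mspace X0. \<forall>y\<in>mspace X0. mdist X x y \<le> C0 * mdist X0 x y) \<and>
    (\<exists>C1>0. \<forall>x\<in>mspace X1. \<forall>y\<in>mspace X1. mdist X x y \<le> C1 * mdist X1 x y)"

text \<open>Only meaningful for pairs in \<open>X0 \<times> X0 \<union> X1 \<times> X1\<close>.\<close>

definition hop :: "'a metric \<Rightarrow> 'a metric \<Rightarrow> real \<Rightarrow> 'a \<Rightarrow> 'a \<Rightarrow> real"
  where "hop X0 X1 t x y =
    (if x \<in> mspace X0 \<inter> mspace X1 \<and> y \<in> mspace X0 \<inter> mspace X1
       then min (mdist X0 x y) (t * mdist X1 x y)
     else if x \<in> mspace X0 \<and> y \<in> mspace X0 then mdist X0 x y
     else t * mdist X1 x y)"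

definition linking_seq :: "'a metric \<Rightarrow> 'a metric \<Rightarrow> 'a \<Rightarrow> 'a \<Rightarrow> nat \<Rightarrow> (nat \<Rightarrow> 'a) \<Rightarrow> bool"
  where "linking_seq X0 X1 x y n z \<longleftrightarrow>
    z 0 = x \<and> z n = y \<and>
    (\<forall>k\<le>n. z k \<in> mspace X0 \<union> mspace X1) \<and>
    (\<forall>k<n. (z k, z (Suc k)) \<in> mspace X0 \<times> mspace X0 \<union> mspace X1 \<times> mspace X1)"

definition K_M :: "'a metric \<Rightarrow> 'a metric \<Rightarrow> real \<Rightarrow> 'a \<Rightarrow> 'a \<Rightarrow> real"
  where "K_M X0 X1 t x y =
    Inf {(\<Sum>k<n. hop X0 X1 t (z k) (z (Suc k))) | n z. linking_seq X0 X1 x y n z}"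

definition J_M :: "'a metric \<Rightarrow> 'a metric \<Rightarrow> real \<Rightarrow> 'a \<Rightarrow> 'a \<Rightarrow> real"
  where "J_M X0 X1 t x y = max (mdist X0 x y) (t * mdist X1 x y)"

section \<open>The metric \<open>\<delta>\<close>\<close>

definition ennreal_powr :: "ennreal \<Rightarrow> real \<Rightarrow> ennreal"
  where "ennreal_powr a r = (if a = top then top else ennreal (enn2real a powr r))"

definition Gamma_fun :: "real \<Rightarrow> ereal \<Rightarrow> (int \<Rightarrow> real) \<Rightarrow> ennreal"
  where "Gamma_fun \<theta> q a =
    (if q = \<infinity> then (SUP k. ennreal (2 powr (- of_int k * \<theta>) * \<bar>a k\<bar>))
     else ennreal_powr
       (\<Sum>\<^sub>\<infinity>k\<in>UNIV. ennreal ((2 powr (- of_int k * \<theta>) * \<bar>a k\<bar>) powr real_of_ereal q))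
       (1 / real_of_ereal q))"

definition approx_seqs :: "'a metric \<Rightarrow> 'a metric \<Rightarrow> 'a \<Rightarrow> (nat \<Rightarrow> 'a) set"
  where "approx_seqs X0 X1 x =
    {u. Metric_space.MCauchy (mspace X0 \<inter> mspace X1) (J_M X0 X1 1) u \<and>
        (\<lambda>n. K_M X0 X1 1 (u n) x) \<longlonglongrightarrow> 0}"

definition splice_seq :: "(nat \<Rightarrow> 'a) \<Rightarrow> (nat \<Rightarrow> 'a) \<Rightarrow> int \<Rightarrow> 'a"
  where "splice_seq u v k = (if k \<ge> 0 then u (nat k) else v (nat (- k)))"

definition p_fun :: "'a metric \<Rightarrow> 'a metric \<Rightarrow> real \<Rightarrow> ereal \<Rightarrow> 'a \<Rightarrow> 'a \<Rightarrow> ennreal"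
  where "p_fun X0 X1 \<theta> q x y =
    (INF u\<in>approx_seqs X0 X1 x. INF v\<in>approx_seqs X0 X1 y.
       Gamma_fun \<theta> q
         (\<lambda>k. J_M X0 X1 (2 powi k) (splice_seq u v k) (splice_seq u v (k + 1))))"

definition P_fun :: "'a metric \<Rightarrow> 'a metric \<Rightarrow> real \<Rightarrow> ereal \<Rightarrow> 'a \<Rightarrow> 'a \<Rightarrow> ennreal"
  where "P_fun X0 X1 \<theta> q x y = (p_fun X0 X1 \<theta> q x y + p_fun X0 X1 \<theta> q y x) / 2"

text \<open>
  On \<open>X0 \<inter> X1\<close> the infimum is finite: for constant approximating sequences at most one
  term of the spliced sequence of distances is nonzero. So \<open>enn2real\<close> loses no information.
\<close>

definition delta_R :: "'a metric \<Rightarrow> 'a metric \<Rightarrow> real \<Rightarrow> ereal \<Rightarrow> 'a \<Rightarrow> 'a \<Rightarrow> real"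
  where "delta_R X0 X1 \<theta> q x y =
    enn2real (Inf {(\<Sum>j<n. P_fun X0 X1 \<theta> q (z j) (z (Suc j))) | n z.
      z 0 = x \<and> z n = y \<and> (\<forall>j\<le>n. z j \<in> mspace X0 \<inter> mspace X1)})"

section \<open>Relative completion and the \<open>R\<close>-interpolated space\<close>

definition relative_completion ::
    "'a set \<Rightarrow> ('a \<Rightarrow> 'a \<Rightarrow> real) \<Rightarrow> 'a set \<Rightarrow> ('a \<Rightarrow> 'a \<Rightarrow> real) \<Rightarrow> 'a set"
  where "relative_completion A dA B dB =
    {x \<in> B. \<exists>\<sigma>. Metric_space.MCauchy A dA \<sigma> \<and> (\<lambda>n. dB (\<sigma> n) x) \<longlonglongrightarrow> 0}"

text \<open>
  \<open>m\<close> is the relative completion equipped with a metric having the characteristic properties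
  of \<open>d\<^bsub>A,B\<^esub>\<close>. These properties are not assumed to determine the metric uniquely.
\<close>

definition is_relative_completion ::
    "'a set \<Rightarrow> ('a \<Rightarrow> 'a \<Rightarrow> real) \<Rightarrow> 'a set \<Rightarrow> ('a \<Rightarrow> 'a \<Rightarrow> real) \<Rightarrow> 'a metric \<Rightarrow> bool"
  where "is_relative_completion A dA B dB m \<longleftrightarrow>
    mspace m = relative_completion A dA B dB \<and>
    (\<forall>x\<in>A. \<forall>y\<in>A. mdist m x y = dA x y) \<and>
    (\<forall>c>0. (\<forall>x\<in>A. \<forall>y\<in>A. dB x y \<le> c * dA x y) \<longrightarrow>
       (\<forall>x\<in>mspace m. \<forall>y\<in>mspace m. dB x y \<le> c * mdist m x y)) \<and>
    mtopology_of m closure_of A = mspace m \<and>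
    (Metric_space.mcomplete B dB \<longrightarrow> mcomplete_of m)"

definition is_R_interpolated_space ::
    "'a metric \<Rightarrow> 'a metric \<Rightarrow> real \<Rightarrow> ereal \<Rightarrow> 'a metric \<Rightarrow> bool"
  where "is_R_interpolated_space X0 X1 \<theta> q R \<longleftrightarrow>
    is_relative_completion (mspace X0 \<inter> mspace X1) (delta_R X0 X1 \<theta> q)
      (mspace X0 \<union> mspace X1) (K_M X0 X1 1) R"

end

theory Submission
  imports Defs
begin

text \<open>
  With \<open>a = 2\<^bsup>\<theta>-1\<^esup>\<close> and \<open>b = 2\<^bsup>-\<theta>\<^esup>\<close>, every hop of a spliced sequence satisfies
  \<open>K(1; S\<^sub>k, S\<^sub>k\<^sub>+\<^sub>1) \<le> min(1, 2\<^bsup>-k\<^esup>) J(2\<^bsup>k\<^esup>; S\<^sub>k, S\<^sub>k\<^sub>+\<^sub>1)\<close>, which is at most \<open>a\<^bsup>k\<^esup> \<Gamma>\<close> for \<open>k \<ge> 0\<close> and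
  \<open>b\<^bsup>-k\<^esup> \<Gamma>\<close> for \<open>k < 0\<close>, since \<open>\<Gamma>\<close> dominates each single weighted term.  Summing the two geometric
  series bounds \<open>K(1)\<close> by a multiple of \<open>\<delta>\<close>, and hence by the same multiple of \<open>\<Delta>\<close>.  As \<open>T\<close> is
  Lipschitz along each link of a linking sequence, it is Lipschitz for \<open>K(1)\<close> and so for \<open>\<Delta>\<close>.
  For compactness, a \<open>\<Delta>\<close>-bounded sequence is perturbed into \<open>X\<^sub>0 \<inter> X\<^sub>1\<close> by density; the perturbed
  sequence is bounded in \<open>X\<^sub>0\<close>, and its image has a convergent subsequence.
\<close>

lemma mdist_refl: "x \<in> mspace m \<Longrightarrow> mdist m x x = 0"
  by simp

section \<open>The hop and \<open>K\<close>-functionals\<close>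

lemma hop_nonneg: "0 \<le> t \<Longrightarrow> 0 \<le> hop X0 X1 t x y"
  by (simp add: hop_def)

lemma hop_commute: "hop X0 X1 t x y = hop X0 X1 t y x"
  by (auto simp: hop_def mdist_commute)

lemma K_M_le_sum:
  assumes "0 \<le> t" and "linking_seq X0 X1 x y n z"
  shows "K_M X0 X1 t x y \<le> (\<Sum>k<n. hop X0 X1 t (z k) (z (Suc k)))"
  unfolding K_M_def
proof (rule cInf_lower)
  show "bdd_below {(\<Sum>k<n. hop X0 X1 t (z k) (z (Suc k))) | n z. linking_seq X0 X1 x y n z}"
    by (rule bdd_belowI[where m = 0]) (auto intro!: sum_nonneg hop_nonneg assms(1))
qed (use assms(2) in blast)

text \<open>A point \<open>w\<close> of the intersection shares a space with \<open>x\<close> and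
  with \<open>y\<close>, so two hops suffice. This keeps the set under \<open>Inf\<close> in
  \<open>K_M\<close> nonempty.\<close>

lemma linking_seq_exists:
  assumes "mspace X0 \<inter> mspace X1 \<noteq> {}"
    and "x \<in> mspace X0 \<union> mspace X1" "y \<in> mspace X0 \<union> mspace X1"
  obtains n z where "linking_seq X0 X1 x y n z"
proof -
  obtain w where w: "w \<in> mspace X0" "w \<in> mspace X1"
    using assms(1) by blast
  have "linking_seq X0 X1 x y 2 (\<lambda>k. if k = 0 then x else if k = 1 then w else y)"
    using w assms(2,3) by (auto simp: linking_seq_def less_2_cases_iff)
  then show thesis
    by (rule that)
qed

lemma K_M_greatest:
  assumes "mspace X0 \<inter> mspace X1 \<noteq> {}"
    and "x \<in> mspace X0 \<union> mspace X1" "y \<in> mspace X0 \<union> mspace X1"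
    and "\<And>n z. linking_seq X0 X1 x y n z \<Longrightarrow> c \<le> (\<Sum>k<n. hop X0 X1 t (z k) (z (Suc k)))"
  shows "c \<le> K_M X0 X1 t x y"
  unfolding K_M_def
proof (rule cInf_greatest)
  show "{(\<Sum>k<n. hop X0 X1 t (z k) (z (Suc k))) | n z. linking_seq X0 X1 x y n z} \<noteq> {}"
    using linking_seq_exists[OF assms(1-3)] by blast
qed (use assms(4) in blast)

section \<open>Symmetry and triangle inequality of the K-functional\<close>

lemma linking_seq_rev:
  assumes "linking_seq X0 X1 x y n z"
  shows "linking_seq X0 X1 y x n (\<lambda>k. z (n - k))"
  unfolding linking_seq_def
proof (intro conjI allI impI)
  fix k assume "k < n"
  then have "n - Suc k < n" "Suc (n - Suc k) = n - k"
    by auto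
  then show "(z (n - k), z (n - Suc k)) \<in> mspace X0 \<times> mspace X0 \<union> mspace X1 \<times> mspace X1"
    using assms unfolding linking_seq_def by (metis SigmaD1 SigmaD2 SigmaI UnE UnI1 UnI2)
qed (use assms in \<open>auto simp: linking_seq_def\<close>)

lemma K_M_commute:
  assumes "0 \<le> t" and "mspace X0 \<inter> mspace X1 \<noteq> {}"
    and "x \<in> mspace X0 \<union> mspace X1" "y \<in> mspace X0 \<union> mspace X1"
  shows "K_M X0 X1 t x y = K_M X0 X1 t y x"
proof -
  have le: "K_M X0 X1 t x y \<le> K_M X0 X1 t y x"
    if xy: "x \<in> mspace X0 \<union> mspace X1" "y \<in> mspace X0 \<union> mspace X1" for x y
  proof (rule K_M_greatest[OF assms(2) xy(2,1)])
    fix n z assume z: "linking_seq X0 X1 y x n z"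
    have "K_M X0 X1 t x y \<le> (\<Sum>k<n. hop X0 X1 t (z (n - k)) (z (n - Suc k)))"
      by (rule K_M_le_sum[OF assms(1) linking_seq_rev[OF z]])
    \<comment> \<open>Symmetry of \<open>hop\<close> gives each summand the form
      \<open>f (n - Suc k)\<close>, which reindexing turns into \<open>f k\<close>.\<close>
    also have "\<dots> = (\<Sum>k<n. hop X0 X1 t (z (n - Suc k)) (z (Suc (n - Suc k))))"
      by (intro sum.cong refl) (auto simp: hop_commute Suc_diff_Suc)
    also have "\<dots> = (\<Sum>k<n. hop X0 X1 t (z k) (z (Suc k)))"
      by (rule sum.nat_diff_reindex)
    finally show "K_M X0 X1 t x y \<le> (\<Sum>k<n. hop X0 X1 t (z k) (z (Suc k)))" .
  qed
  show ?thesis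
    using le assms(3,4) by (intro antisym) auto
qed

lemma linking_seq_append:
  assumes "linking_seq X0 X1 x y n z" and "linking_seq X0 X1 y w m z'"
  shows "linking_seq X0 X1 x w (n + m) (\<lambda>k. if k \<le> n then z k else z' (k - n))"
  unfolding linking_seq_def
proof (intro conjI allI impI)
  fix k assume k: "k < n + m"
  show "(if k \<le> n then z k else z' (k - n), if Suc k \<le> n then z (Suc k) else z' (Suc k - n))
          \<in> mspace X0 \<times> mspace X0 \<union> mspace X1 \<times> mspace X1"
  proof (cases "k < n")
    case True
    then show ?thesis using assms(1) by (simp add: linking_seq_def)
  next
    case False
    \<comment> \<open>At the seam \<open>k = n\<close> the first branch gives \<open>z n\<close>,
      which is \<open>y = z' 0\<close>; so both ends of the hop lie on \<open>z'\<close>.\<close>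
    then have "(if k \<le> n then z k else z' (k - n)) = z' (k - n)" "Suc k - n = Suc (k - n)"
      using assms by (auto simp: linking_seq_def)
    moreover have "(z' (k - n), z' (Suc (k - n))) \<in> mspace X0 \<times> mspace X0 \<union> mspace X1 \<times> mspace X1"
      using assms(2) k False by (auto simp: linking_seq_def)
    ultimately show ?thesis
      using False by simp
  qed
qed (use assms in \<open>auto simp: linking_seq_def\<close>)

lemma K_M_triangle:
  assumes "0 \<le> t" and "mspace X0 \<inter> mspace X1 \<noteq> {}"
    and x: "x \<in> mspace X0 \<union> mspace X1" and y: "y \<in> mspace X0 \<union> mspace X1"
    and w: "w \<in> mspace X0 \<union> mspace X1"
  shows "K_M X0 X1 t x w \<le> K_M X0 X1 t x y + K_M X0 X1 t y w"
proof -
  let ?s = "\<lambda>n z. \<Sum>k<n. hop X0 X1 t (z k) (z (Suc k))"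
  have sum_split: "(\<Sum>k<n + m. f k) = (\<Sum>k<n. f k) + (\<Sum>k<m. f (n + k))"
    for f :: "nat \<Rightarrow> real" and n m
    by (induction m) (auto simp: add.assoc)
  \<comment> \<open>The two infima are taken one after the other: \<open>z\<close> stays fixed while
    \<open>z'\<close> varies, then the inequality is rearranged and the infimum over
    \<open>z\<close> is taken.\<close>
  have "K_M X0 X1 t x w - ?s n z \<le> K_M X0 X1 t y w" if z: "linking_seq X0 X1 x y n z" for n z
  proof (rule K_M_greatest[OF assms(2) y w])
    fix m z' assume z': "linking_seq X0 X1 y w m z'"
    let ?u = "\<lambda>k. if k \<le> n then z k else z' (k - n)"
    have "K_M X0 X1 t x w \<le> ?s (n + m) ?u"
      by (rule K_M_le_sum[OF assms(1) linking_seq_append[OF z z']])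
    also have "\<dots> = ?s n ?u + (\<Sum>k<m. hop X0 X1 t (?u (n + k)) (?u (Suc (n + k))))"
      by (rule sum_split)
    also have "?s n ?u = ?s n z"
      by (intro sum.cong) auto
    also have "(\<Sum>k<m. hop X0 X1 t (?u (n + k)) (?u (Suc (n + k)))) = ?s m z'"
      using z z' by (intro sum.cong) (auto simp: linking_seq_def)
    finally show "K_M X0 X1 t x w - ?s n z \<le> ?s m z'"
      by simp
  qed
  then have "K_M X0 X1 t x w - K_M X0 X1 t y w \<le> K_M X0 X1 t x y"
    by (intro K_M_greatest[OF assms(2) x y]) (simp add: algebra_simps)
  then show ?thesis
    by simp
qed

lemma K_M_nonneg:
  assumes "0 \<le> t" and "mspace X0 \<inter> mspace X1 \<noteq> {}"
    and "x \<in> mspace X0 \<union> mspace X1" "y \<in> mspace X0 \<union> mspace X1"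
  shows "0 \<le> K_M X0 X1 t x y"
  by (intro K_M_greatest[OF assms(2-4)] sum_nonneg hop_nonneg assms(1))

lemma K_M_refl:
  assumes "0 \<le> t" and "mspace X0 \<inter> mspace X1 \<noteq> {}" and x: "x \<in> mspace X0 \<union> mspace X1"
  shows "K_M X0 X1 t x x = 0"
  using K_M_nonneg[OF assms(1,2) x x] K_M_le_sum[OF assms(1), of X0 X1 x x 0 "\<lambda>_. x"] x
  by (simp add: linking_seq_def)

lemma K_M_le_hop:
  assumes "0 \<le> t"
    and "(x, y) \<in> mspace X0 \<times> mspace X0 \<union> mspace X1 \<times> mspace X1"
  shows "K_M X0 X1 t x y \<le> hop X0 X1 t x y"
  using K_M_le_sum[OF assms(1), of X0 X1 x y 1 "\<lambda>k. if k = 0 then x else y"] assms(2)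
  by (auto simp: linking_seq_def)

lemma K_M_sum_chain:
  assumes t: "0 \<le> t" and "mspace X0 \<inter> mspace X1 \<noteq> {}"
    and "\<And>j. j \<le> n \<Longrightarrow> z j \<in> mspace X0 \<union> mspace X1"
  shows "K_M X0 X1 t (z 0) (z n) \<le> (\<Sum>j<n. K_M X0 X1 t (z j) (z (Suc j)))"
  using assms(3)
proof (induction n)
  case 0
  then show ?case using K_M_refl[OF t assms(2)] by simp
next
  case (Suc n)
  have "K_M X0 X1 t (z 0) (z (Suc n)) \<le> K_M X0 X1 t (z 0) (z n) + K_M X0 X1 t (z n) (z (Suc n))"
    by (intro K_M_triangle[OF t assms(2)] Suc.prems) auto
  then show ?case
    using Suc by simp
qed

section \<open>Lipschitz estimate with respect to the K-metric\<close>

lemma Lipschitz_K_M: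
  assumes ne: "mspace X0 \<inter> mspace X1 \<noteq> {}"
    and "Lipschitz_continuous_map X0 F T" and "Lipschitz_continuous_map X1 F T"
  obtains L where "L > 0" and "\<And>x y. x \<in> mspace X0 \<union> mspace X1 \<Longrightarrow> y \<in> mspace X0 \<union> mspace X1 \<Longrightarrow>
    mdist F (T x) (T y) \<le> L * K_M X0 X1 1 x y"
proof -
  obtain L0 where L0: "L0 > 0" "T \<in> mspace X0 \<rightarrow> mspace F"
    "\<And>x y. x \<in> mspace X0 \<Longrightarrow> y \<in> mspace X0 \<Longrightarrow> mdist F (T x) (T y) \<le> L0 * mdist X0 x y"
    using assms(2) unfolding Lipschitz_continuous_map_pos by blast
  obtain L1 where L1: "L1 > 0" "T \<in> mspace X1 \<rightarrow> mspace F"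
    "\<And>x y. x \<in> mspace X1 \<Longrightarrow> y \<in> mspace X1 \<Longrightarrow> mdist F (T x) (T y) \<le> L1 * mdist X1 x y"
    using assms(3) unfolding Lipschitz_continuous_map_pos by blast
  \<comment> \<open>One constant for both spaces, so that the estimate holds whichever distance
    realises the minimum in \<open>hop\<close>.\<close>
  define L where "L = max L0 L1"
  have "L > 0"
    using L0(1) by (simp add: L_def)
  have in_F: "T x \<in> mspace F" if "x \<in> mspace X0 \<union> mspace X1" for x
    using that L0(2) L1(2) by blast
  have d0: "mdist F (T x) (T y) \<le> L * mdist X0 x y" if "x \<in> mspace X0" "y \<in> mspace X0" for x y
    using L0(3)[OF that] mult_right_mono[of L0 L "mdist X0 x y"] by (simp add: L_def)
  have d1: "mdist F (T x) (T y) \<le> L * mdist X1 x y" if "x \<in> mspace X1" "y \<in> mspace X1" for x y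
    using L1(3)[OF that] mult_right_mono[of L1 L "mdist X1 x y"] by (simp add: L_def)
  have hop: "mdist F (T x) (T y) \<le> L * hop X0 X1 1 x y"
    if "(x, y) \<in> mspace X0 \<times> mspace X0 \<union> mspace X1 \<times> mspace X1" for x y
    using that d0[of x y] d1[of x y] by (auto simp: hop_def min_def)
  have chain: "mdist F (T (z 0)) (T (z n)) \<le> L * (\<Sum>k<n. hop X0 X1 1 (z k) (z (Suc k)))"
    if "\<forall>k\<le>n. z k \<in> mspace X0 \<union> mspace X1"
      "\<forall>k<n. (z k, z (Suc k)) \<in> mspace X0 \<times> mspace X0 \<union> mspace X1 \<times> mspace X1" for n z
    using that
  proof (induction n)
    case 0
    then have "T (z 0) \<in> mspace F"
      by (intro in_F) auto
    then show ?case by (simp add: mdist_refl)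
  next
    case (Suc n)
    have "mdist F (T (z 0)) (T (z (Suc n)))
        \<le> mdist F (T (z 0)) (T (z n)) + mdist F (T (z n)) (T (z (Suc n)))"
      using Suc.prems(1) by (intro mdist_triangle in_F) auto
    moreover have "mdist F (T (z n)) (T (z (Suc n))) \<le> L * hop X0 X1 1 (z n) (z (Suc n))"
      using Suc.prems(2) by (intro hop) auto
    ultimately show ?case
      using Suc by (simp add: ring_distribs)
  qed
  show thesis
  proof (rule that[OF \<open>L > 0\<close>])
    fix x y assume xy: "x \<in> mspace X0 \<union> mspace X1" "y \<in> mspace X0 \<union> mspace X1"
    \<comment> \<open>Dividing by \<open>L\<close> isolates \<open>K_M\<close>, so that the left
      side is a lower bound of all link lengths.\<close>
    have "mdist F (T x) (T y) / L \<le> K_M X0 X1 1 x y"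
    proof (rule K_M_greatest[OF ne xy])
      fix n z assume "linking_seq X0 X1 x y n z"
      then show "mdist F (T x) (T y) / L \<le> (\<Sum>k<n. hop X0 X1 1 (z k) (z (Suc k)))"
        using chain[of n z] \<open>L > 0\<close> by (auto simp: linking_seq_def field_simps)
    qed
    then show "mdist F (T x) (T y) \<le> L * K_M X0 X1 1 x y"
      using \<open>L > 0\<close> by (simp add: field_simps)
  qed
qed

section \<open>The functional \<open>\<Gamma>\<close>\<close>

text \<open>The root of order \<open>r\<close> is monotone and undoes the power; \<open>top\<close>
  is its own root.\<close>

lemma ennreal_powr_ge:
  assumes "ennreal (x powr r) \<le> s" and "0 \<le> x" and "0 < r"
  shows "ennreal x \<le> ennreal_powr s (1 / r)"
proof (cases s)
  case (real c)
  then have "x powr r \<le> c"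
    using assms(1) by simp
  then have "(x powr r) powr (1 / r) \<le> c powr (1 / r)"
    using assms(3) by (intro powr_mono2) auto
  then show ?thesis
    using assms real by (simp add: ennreal_powr_def powr_powr)
qed (simp add: ennreal_powr_def)

lemma real_of_ereal_ge_1:
  assumes "1 \<le> q" and "q \<noteq> \<infinity>"
  shows "1 \<le> real_of_ereal q"
  using assms by (cases q) (auto simp: one_ereal_def)

text \<open>A sum of nonnegative terms dominates each of them, and so does a supremum. This
  single-term bound makes the comparison with \<open>K_M\<close> independent of
  \<open>q\<close>.\<close>

lemma Gamma_fun_ge_term:
  assumes "1 \<le> q"
  shows "ennreal (2 powr (- of_int k * \<theta>) * \<bar>a k\<bar>) \<le> Gamma_fun \<theta> q a"
proof (cases "q = \<infinity>")
  case True
  then show ?thesis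
    by (auto simp: Gamma_fun_def intro: SUP_upper)
next
  case False
  let ?r = "real_of_ereal q"
  let ?f = "\<lambda>k::int. ennreal ((2 powr (- of_int k * \<theta>) * \<bar>a k\<bar>) powr ?r)"
  have "infsum ?f {k} \<le> infsum ?f UNIV"
    by (rule infsum_mono_neutral) (auto intro: nonneg_summable_on_complete)
  then have "ennreal (2 powr (- of_int k * \<theta>) * \<bar>a k\<bar>) \<le> ennreal_powr (infsum ?f UNIV) (1 / ?r)"
    using real_of_ereal_ge_1[OF assms False] by (intro ennreal_powr_ge) auto
  then show ?thesis
    using False by (simp add: Gamma_fun_def)
qed

text \<open>Only the term at \<open>i\<close> survives, since \<open>0 powr r = 0\<close>. This
  serves the splice of two constant sequences.\<close>

lemma Gamma_fun_single_finite:
  assumes "\<And>k. k \<noteq> i \<Longrightarrow> a k = 0"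
  shows "Gamma_fun \<theta> q a < top"
proof (cases "q = \<infinity>")
  case True
  have "(SUP k. ennreal (2 powr (- of_int k * \<theta>) * \<bar>a k\<bar>))
      \<le> ennreal (2 powr (- of_int i * \<theta>) * \<bar>a i\<bar>)"
  proof (rule SUP_least)
    fix k :: int
    show "ennreal (2 powr (- of_int k * \<theta>) * \<bar>a k\<bar>) \<le> ennreal (2 powr (- of_int i * \<theta>) * \<bar>a i\<bar>)"
      using assms[of k] by (cases "k = i") auto
  qed
  also have "\<dots> < top"
    by simp
  finally show ?thesis
    using True by (simp add: Gamma_fun_def)
next
  case False
  let ?f = "\<lambda>k::int. ennreal ((2 powr (- of_int k * \<theta>) * \<bar>a k\<bar>) powr real_of_ereal q)"
  have "infsum ?f UNIV = infsum ?f {i}"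
    by (rule infsum_cong_neutral) (use assms in auto)
  also have "\<dots> = ?f i"
    by simp
  finally have "infsum ?f UNIV = ?f i" .
  then show ?thesis
    using False by (simp add: Gamma_fun_def ennreal_powr_def)
qed

section \<open>Comparison of \<open>K\<close> with \<open>\<delta>\<close>\<close>

lemma Metric_space_J_M:
  assumes "0 \<le> t"
  shows "Metric_space (mspace X0 \<inter> mspace X1) (J_M X0 X1 t)"
proof
  fix x y
  show "0 \<le> J_M X0 X1 t x y"
    by (simp add: J_M_def le_max_iff_disj)
  show "J_M X0 X1 t x y = J_M X0 X1 t y x"
    by (simp add: J_M_def mdist_commute)
next
  fix x y assume xy: "x \<in> mspace X0 \<inter> mspace X1" "y \<in> mspace X0 \<inter> mspace X1"
  \<comment> \<open>Separation comes from the \<open>X0\<close> component of the maximum, so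
    \<open>t = 0\<close> is covered too.\<close>
  have "mdist X0 x y \<le> J_M X0 X1 t x y" "0 \<le> t * mdist X1 x y"
    using assms by (auto simp: J_M_def)
  then have "x = y" if "J_M X0 X1 t x y = 0"
    using that xy mdist_nonneg[of X0 x y] mdist_zero[of x X0 y] by auto
  moreover have "J_M X0 X1 t x x = 0"
    using xy by (simp add: J_M_def mdist_refl)
  ultimately show "J_M X0 X1 t x y = 0 \<longleftrightarrow> x = y"
    by blast
next
  fix x y z
  assume xyz: "x \<in> mspace X0 \<inter> mspace X1" "y \<in> mspace X0 \<inter> mspace X1" "z \<in> mspace X0 \<inter> mspace X1"
  have "mdist X0 x z \<le> mdist X0 x y + mdist X0 y z"
    using xyz by (intro mdist_triangle) auto
  moreover have "t * mdist X1 x z \<le> t * (mdist X1 x y + mdist X1 y z)"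
    using xyz assms by (intro mult_left_mono mdist_triangle) auto
  ultimately show "J_M X0 X1 t x z \<le> J_M X0 X1 t x y + J_M X0 X1 t y z"
    by (auto simp: J_M_def ring_distribs)
qed

lemma approx_seqsD:
  assumes "u \<in> approx_seqs X0 X1 x"
  shows "u n \<in> mspace X0 \<inter> mspace X1" and "(\<lambda>n. K_M X0 X1 1 (u n) x) \<longlonglongrightarrow> 0"
  using assms Metric_space.MCauchy_def[OF Metric_space_J_M[of 1 X0 X1], of u]
  by (auto simp: approx_seqs_def)

lemma const_in_approx_seqs:
  assumes "x \<in> mspace X0 \<inter> mspace X1"
  shows "(\<lambda>_. x) \<in> approx_seqs X0 X1 x"
proof -
  have "K_M X0 X1 1 x x = 0"
    using assms by (intro K_M_refl) auto
  then show ?thesis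
    using assms Metric_space.MCauchy_const[OF Metric_space_J_M[of 1 X0 X1]]
    by (auto simp: approx_seqs_def)
qed

text \<open>One hop costs at most the smaller of the two distances, while \<open>J_M\<close>
  dominates both the first distance and \<open>t\<close> times the second. The first bound serves
  the indices \<open>k < 0\<close> of a splice, the second those with
  \<open>k \<ge> 0\<close>.\<close>

lemma K_M_le_J_M:
  assumes "0 < t" and xy: "x \<in> mspace X0 \<inter> mspace X1" "y \<in> mspace X0 \<inter> mspace X1"
  shows "K_M X0 X1 1 x y \<le> J_M X0 X1 t x y" and "K_M X0 X1 1 x y \<le> J_M X0 X1 t x y / t"
proof -
  have "K_M X0 X1 1 x y \<le> min (mdist X0 x y) (mdist X1 x y)"
    using K_M_le_hop[of 1 x y X0 X1] xy by (simp add: hop_def)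
  then show "K_M X0 X1 1 x y \<le> J_M X0 X1 t x y" "K_M X0 X1 1 x y \<le> J_M X0 X1 t x y / t"
    using assms(1) by (auto simp: J_M_def pos_le_divide_eq le_max_iff_disj mult.commute)
qed

text \<open>The constant in \<open>K \<le> c \<delta>\<close>: the sum of the two geometric series with ratios
  \<open>2\<^bsup>\<theta>-1\<^esup>\<close> and \<open>2\<^bsup>-\<theta>\<^esup>\<close>.\<close>

definition splice_const :: "real \<Rightarrow> real"
  where "splice_const \<theta> = 1 / (1 - 2 powr (\<theta> - 1)) + 1 / (1 - 2 powr (- \<theta>))"

lemma splice_const_pos:
  assumes "0 < \<theta>" "\<theta> < 1"
  shows "0 < splice_const \<theta>"
proof -
  have "2 powr (\<theta> - 1) < 1" "2 powr (- \<theta>) < 1"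
    using assms by (auto intro: powr_less_one)
  then show ?thesis
    unfolding splice_const_def by (intro add_pos_pos divide_pos_pos) auto
qed

lemma geometric_partial_sum_le:
  fixes a :: real
  assumes "0 \<le> a" "a < 1"
  shows "(\<Sum>j<n. a ^ j) \<le> 1 / (1 - a)"
  using assms by (simp add: sum_gp_strict divide_right_mono)

text \<open>The distance from \<open>x\<close> to \<open>y\<close> is measured along the splice,
  whose two halves have geometrically decreasing hops away from the centre. Only a uniform bound
  \<open>M\<close> on the weighted terms enters, as in the case of infinite
  \<open>q\<close>.\<close>

lemma K_M_le_splice:
  assumes ne: "mspace X0 \<inter> mspace X1 \<noteq> {}" and \<theta>: "0 < \<theta>" "\<theta> < 1"
    and x: "x \<in> mspace X0 \<union> mspace X1" and y: "y \<in> mspace X0 \<union> mspace X1"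
    and u: "u \<in> approx_seqs X0 X1 x" and v: "v \<in> approx_seqs X0 X1 y"
    and M: "\<And>k. 2 powr (- of_int k * \<theta>) *
      J_M X0 X1 (2 powi k) (splice_seq u v k) (splice_seq u v (k + 1)) \<le> M"
  shows "K_M X0 X1 1 x y \<le> splice_const \<theta> * M"
proof -
  let ?K = "K_M X0 X1 1"
  let ?S = "splice_seq u v"
  \<comment> \<open>\<open>a\<close> is the ratio of the sequence
    \<open>2 powr (k * \<theta>) / 2 powi k\<close> for growing \<open>k\<close>, and
    \<open>b\<close> that of \<open>2 powr (k * \<theta>)\<close> for falling \<open>k\<close>; both
    are below 1 as \<theta> lies strictly between 0 and 1.\<close>
  define a where "a = 2 powr (\<theta> - 1)"
  define b where "b = 2 powr (- \<theta>)"
  have ab: "0 < a" "a < 1" "0 < b" "b < 1"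
    using \<theta> by (auto simp: a_def b_def intro: powr_less_one)
  have u_in: "u n \<in> mspace X0 \<inter> mspace X1" and v_in: "v n \<in> mspace X0 \<inter> mspace X1" for n
    using approx_seqsD(1)[OF u] approx_seqsD(1)[OF v] by auto
  then have S_in: "?S k \<in> mspace X0 \<inter> mspace X1" for k
    unfolding splice_seq_def by presburger
  note tri = K_M_triangle[of 1, OF _ ne] and nonneg = K_M_nonneg[of 1, OF _ ne]
    and sym = K_M_commute[of 1, OF _ ne]
  have J_le: "J_M X0 X1 (2 powi k) (?S k) (?S (k + 1)) \<le> 2 powr (of_int k * \<theta>) * M" for k
    using M[of k] by (simp add: powr_minus field_simps)
  \<comment> \<open>The weight at \<open>k = 0\<close> is 1, so \<open>M\<close> dominates a value
    of \<open>J_M\<close>, hence one of \<open>K_M\<close>.\<close>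
  have "0 \<le> M"
    using M[of 0] nonneg[of "?S 0" "?S 1"] K_M_le_J_M(1)[of 1 "?S 0" X0 X1 "?S 1"] S_in[of 0] S_in[of 1]
    by auto
  have step_u: "?K (u j) (u (Suc j)) \<le> a ^ j * M" for j
  proof -
    let ?k = "int j"
    have S: "?S ?k = u j" "?S (?k + 1) = u (Suc j)"
      by (auto simp: splice_seq_def nat_add_distrib)
    have "?K (u j) (u (Suc j)) \<le> J_M X0 X1 (2 powi ?k) (u j) (u (Suc j)) / 2 powi ?k"
      by (intro K_M_le_J_M(2) u_in) auto
    also have "\<dots> \<le> (2 powr (of_int ?k * \<theta>) * M) / 2 powi ?k"
      using J_le[of ?k] unfolding S by (intro divide_right_mono) auto
    also have "\<dots> = a ^ j * M"
    proof -
      have "a ^ j = 2 powr ((\<theta> - 1) * real j)"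
        by (simp add: a_def powr_realpow[symmetric] powr_powr)
      also have "\<dots> = 2 powr (real j * \<theta>) / 2 powi int j"
        by (simp add: powr_diff[symmetric] powr_realpow[symmetric] algebra_simps)
      finally show ?thesis
        by simp
    qed
    finally show ?thesis .
  qed
  \<comment> \<open>With \<open>k = -(j + 1)\<close> the hop leads from \<open>v (Suc j)\<close> to
    \<open>?S (- int j)\<close>. The latter stays unevaluated: for \<open>j = 0\<close> it is
    \<open>u 0\<close>, as \<open>v 0\<close> never occurs in the splice.\<close>
  have step_v: "?K (v (Suc j)) (?S (- int j)) \<le> b ^ Suc j * M" for j
  proof -
    let ?k = "- int (Suc j)"
    have S: "?S ?k = v (Suc j)" "?S (?k + 1) = ?S (- int j)"
      by (simp add: splice_seq_def del: of_nat_Suc) simp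
    have "?K (?S ?k) (?S (?k + 1)) \<le> J_M X0 X1 (2 powi ?k) (?S ?k) (?S (?k + 1))"
      by (intro K_M_le_J_M(1) S_in) auto
    also have "\<dots> \<le> 2 powr (of_int ?k * \<theta>) * M"
      by (rule J_le)
    also have "2 powr (of_int ?k * \<theta>) = b ^ Suc j"
      unfolding b_def by (simp add: powr_realpow[symmetric] powr_powr field_simps del: power_Suc)
    finally show ?thesis
      unfolding S .
  qed
  have K_u: "?K (u 0) (u n) \<le> 1 / (1 - a) * M" for n
  proof -
    have "?K (u 0) (u n) \<le> (\<Sum>j<n. ?K (u j) (u (Suc j)))"
      using u_in by (intro K_M_sum_chain ne) auto
    also have "\<dots> \<le> (\<Sum>j<n. a ^ j) * M"
      unfolding sum_distrib_right by (intro sum_mono step_u)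
    also have "\<dots> \<le> 1 / (1 - a) * M"
      using ab \<open>0 \<le> M\<close> by (intro mult_right_mono geometric_partial_sum_le) auto
    finally show ?thesis .
  qed
  have K_v: "?K (u 0) (v (Suc n)) \<le> 1 / (1 - b) * M" for n
  proof -
    have "?K (?S (- int 0)) (?S (- int (Suc n))) \<le> (\<Sum>j<Suc n. ?K (?S (- int j)) (?S (- int (Suc j))))"
      using S_in by (intro K_M_sum_chain[where z = "\<lambda>j. ?S (- int j)"] ne) auto
    also have "\<dots> \<le> (\<Sum>j<Suc n. b ^ j * M)"
    proof (rule sum_mono)
      fix j
      have "?S (- int (Suc j)) = v (Suc j)"
        by (simp add: splice_seq_def del: of_nat_Suc)
      then have "?K (?S (- int j)) (?S (- int (Suc j))) \<le> b ^ Suc j * M"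
        using step_v[of j] sym[of "v (Suc j)" "?S (- int j)"] S_in[of "- int j"] v_in[of "Suc j"]
        by auto
      \<comment> \<open>A factor \<open>b\<close> is given away so that the geometric series starts
        at 1.\<close>
      also have "\<dots> \<le> b ^ j * M"
        using ab \<open>0 \<le> M\<close> by (intro mult_right_mono power_decreasing) auto
      finally show "?K (?S (- int j)) (?S (- int (Suc j))) \<le> b ^ j * M" .
    qed
    also have "\<dots> \<le> 1 / (1 - b) * M"
      unfolding sum_distrib_right[symmetric] using ab \<open>0 \<le> M\<close>
      by (intro mult_right_mono geometric_partial_sum_le) auto
    finally show ?thesis
      by (simp add: splice_seq_def del: of_nat_Suc)
  qed
  \<comment> \<open>The route is \<open>x\<close>, \<open>u (Suc n)\<close>, \<open>u 0\<close>,
    \<open>v (Suc n)\<close>, \<open>y\<close>. Its two outer pieces vanish in the limit because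
    \<open>u\<close> and \<open>v\<close> are approximating sequences.\<close>
  have "?K x y \<le> ?K (u (Suc n)) x + splice_const \<theta> * M + ?K (v (Suc n)) y" for n
  proof -
    note mem = x y u_in[of 0, THEN IntD1, THEN UnI1] u_in[of "Suc n", THEN IntD1, THEN UnI1]
      v_in[of "Suc n", THEN IntD1, THEN UnI1]
    have "?K x y \<le> ?K x (u (Suc n)) + ?K (u (Suc n)) y"
      "?K (u (Suc n)) y \<le> ?K (u (Suc n)) (u 0) + ?K (u 0) y"
      "?K (u 0) y \<le> ?K (u 0) (v (Suc n)) + ?K (v (Suc n)) y"
      by (intro tri zero_le_one mem)+
    moreover have "?K x (u (Suc n)) = ?K (u (Suc n)) x" "?K (u (Suc n)) (u 0) = ?K (u 0) (u (Suc n))"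
      by (intro sym zero_le_one mem)+
    moreover have "splice_const \<theta> * M = 1 / (1 - a) * M + 1 / (1 - b) * M"
      by (simp add: splice_const_def a_def b_def ring_distribs)
    ultimately show ?thesis
      using K_u[of "Suc n"] K_v[of n] by linarith
  qed
  moreover have "(\<lambda>n. ?K (u (Suc n)) x + splice_const \<theta> * M + ?K (v (Suc n)) y)
      \<longlonglongrightarrow> 0 + splice_const \<theta> * M + 0"
    by (intro tendsto_intros LIMSEQ_Suc approx_seqsD(2)[OF u] approx_seqsD(2)[OF v])
  ultimately show ?thesis
    using LIMSEQ_le_const by fastforce
qed

section \<open>Passage from spliced sequences to the metric delta\<close>

lemma K_M_le_p_fun:
  assumes ne: "mspace X0 \<inter> mspace X1 \<noteq> {}" and \<theta>: "0 < \<theta>" "\<theta> < 1" and q: "1 \<le> q"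
    and x: "x \<in> mspace X0 \<union> mspace X1" and y: "y \<in> mspace X0 \<union> mspace X1"
  shows "ennreal (K_M X0 X1 1 x y / splice_const \<theta>) \<le> p_fun X0 X1 \<theta> q x y"
  unfolding p_fun_def
proof (intro INF_greatest)
  fix u v assume uv: "u \<in> approx_seqs X0 X1 x" "v \<in> approx_seqs X0 X1 y"
  let ?a = "\<lambda>k. J_M X0 X1 (2 powi k) (splice_seq u v k) (splice_seq u v (k + 1))"
  show "ennreal (K_M X0 X1 1 x y / splice_const \<theta>) \<le> Gamma_fun \<theta> q ?a"
  proof (cases "Gamma_fun \<theta> q ?a")
    case (real M)
    \<comment> \<open>A finite value of \<open>Gamma_fun\<close> is an admissible uniform bound
      \<open>M\<close>; for the value \<open>top\<close> the claim is trivial.\<close>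
    have "2 powr (- of_int k * \<theta>) * ?a k \<le> M" for k
    proof -
      have "ennreal (2 powr (- of_int k * \<theta>) * \<bar>?a k\<bar>) \<le> ennreal M"
        using Gamma_fun_ge_term[OF q, of k \<theta> ?a] real by simp
      then have "2 powr (- of_int k * \<theta>) * \<bar>?a k\<bar> \<le> M"
        using real by simp
      moreover have "2 powr (- of_int k * \<theta>) * ?a k \<le> 2 powr (- of_int k * \<theta>) * \<bar>?a k\<bar>"
        by (intro mult_left_mono) auto
      ultimately show ?thesis
        by linarith
    qed
    then have "K_M X0 X1 1 x y \<le> splice_const \<theta> * M"
      by (rule K_M_le_splice[OF ne \<theta> x y uv])
    then show ?thesis
      using splice_const_pos[OF \<theta>] real by (simp add: field_simps)
  qed simp
qed

lemma p_fun_finite: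
  assumes "x \<in> mspace X0 \<inter> mspace X1" "y \<in> mspace X0 \<inter> mspace X1"
  shows "p_fun X0 X1 \<theta> q x y < top"
proof -
  let ?S = "splice_seq (\<lambda>_. x) (\<lambda>_. y)"
  have "p_fun X0 X1 \<theta> q x y \<le> Gamma_fun \<theta> q (\<lambda>k. J_M X0 X1 (2 powi k) (?S k) (?S (k + 1)))"
    unfolding p_fun_def by (intro INF_lower2[OF const_in_approx_seqs] assms order_refl)
  also have "\<dots> < top"
  proof (rule Gamma_fun_single_finite)
    \<comment> \<open>The splice is \<open>y\<close> for negative indices and \<open>x\<close> from
      0 on, so only the hop from -1 to 0 can be nontrivial.\<close>
    fix k :: int assume "k \<noteq> -1"
    then have "?S k = ?S (k + 1)" "?S k \<in> mspace X0 \<inter> mspace X1"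
      using assms by (auto simp: splice_seq_def)
    then show "J_M X0 X1 (2 powi k) (?S k) (?S (k + 1)) = 0"
      by (simp add: J_M_def mdist_refl)
  qed
  finally show ?thesis .
qed

text \<open>\<open>K_M\<close> is symmetric, so the same lower bound holds for both values that
  \<open>P_fun\<close> averages.\<close>

lemma K_M_le_P_fun:
  assumes ne: "mspace X0 \<inter> mspace X1 \<noteq> {}" and \<theta>: "0 < \<theta>" "\<theta> < 1" and q: "1 \<le> q"
    and x: "x \<in> mspace X0 \<union> mspace X1" and y: "y \<in> mspace X0 \<union> mspace X1"
  shows "ennreal (K_M X0 X1 1 x y / splice_const \<theta>) \<le> P_fun X0 X1 \<theta> q x y"
proof -
  let ?e = "K_M X0 X1 1 x y / splice_const \<theta>"
  have "0 \<le> ?e"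
    using K_M_nonneg[OF _ ne x y] splice_const_pos[OF \<theta>] by simp
  then have "ennreal ?e = (ennreal ?e + ennreal ?e) / 2"
    by (simp add: ennreal_divide_numeral flip: ennreal_plus)
  also have "\<dots> \<le> (p_fun X0 X1 \<theta> q x y + p_fun X0 X1 \<theta> q y x) / 2"
    using K_M_le_p_fun[OF ne \<theta> q x y] K_M_le_p_fun[OF ne \<theta> q y x] K_M_commute[OF _ ne x y, of 1]
    by (intro divide_right_mono_ennreal add_mono) auto
  finally show ?thesis
    by (simp add: P_fun_def)
qed

text \<open>The triangle inequality for \<open>K_M\<close> carries the bound by \<open>P_fun\<close>
  from single steps to every chain, hence to the infimum over chains.\<close>

lemma K_M_le_delta_R:
  assumes ne: "mspace X0 \<inter> mspace X1 \<noteq> {}" and \<theta>: "0 < \<theta>" "\<theta> < 1" and q: "1 \<le> q"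
    and x: "x \<in> mspace X0 \<inter> mspace X1" and y: "y \<in> mspace X0 \<inter> mspace X1"
  shows "K_M X0 X1 1 x y \<le> splice_const \<theta> * delta_R X0 X1 \<theta> q x y"
proof -
  let ?c = "splice_const \<theta>"
  let ?A = "{(\<Sum>j<n. P_fun X0 X1 \<theta> q (z j) (z (Suc j))) | n z.
      z 0 = x \<and> z n = y \<and> (\<forall>j\<le>n. z j \<in> mspace X0 \<inter> mspace X1)}"
  have c: "0 < ?c"
    by (rule splice_const_pos[OF \<theta>])
  have lower: "ennreal (K_M X0 X1 1 x y / ?c) \<le> Inf ?A"
  proof (rule Inf_greatest, clarify)
    fix n and z :: "nat \<Rightarrow> 'a"
    assume z: "x = z 0" "y = z n" "\<forall>j\<le>n. z j \<in> mspace X0 \<inter> mspace X1"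
    have in_B: "z j \<in> mspace X0 \<union> mspace X1" if "j \<le> n" for j
      using z(3) that by blast
    have "K_M X0 X1 1 (z 0) (z n) / ?c \<le> (\<Sum>j<n. K_M X0 X1 1 (z j) (z (Suc j))) / ?c"
      using c in_B by (intro divide_right_mono K_M_sum_chain ne) auto
    then have "ennreal (K_M X0 X1 1 (z 0) (z n) / ?c)
        \<le> ennreal (\<Sum>j<n. K_M X0 X1 1 (z j) (z (Suc j)) / ?c)"
      by (simp add: ennreal_leI sum_divide_distrib)
    also have "\<dots> = (\<Sum>j<n. ennreal (K_M X0 X1 1 (z j) (z (Suc j)) / ?c))"
      using c in_B by (intro sum_ennreal[symmetric] divide_nonneg_pos K_M_nonneg ne) auto
    also have "\<dots> \<le> (\<Sum>j<n. P_fun X0 X1 \<theta> q (z j) (z (Suc j)))"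
      using in_B by (intro sum_mono K_M_le_P_fun ne \<theta> q) auto
    finally show "ennreal (K_M X0 X1 1 (z 0) (z n) / ?c) \<le> (\<Sum>j<n. P_fun X0 X1 \<theta> q (z j) (z (Suc j)))" .
  qed
  \<comment> \<open>Since \<open>enn2real top = 0\<close>, a lower bound survives
    \<open>enn2real\<close> only if the infimum is finite; the one-step chain shows that it
    is.\<close>
  have "Inf ?A \<le> P_fun X0 X1 \<theta> q x y"
  proof (rule Inf_lower, intro CollectI exI conjI)
    show "P_fun X0 X1 \<theta> q x y = (\<Sum>j<1. P_fun X0 X1 \<theta> q
        ((\<lambda>j::nat. if j = 0 then x else y) j) ((\<lambda>j::nat. if j = 0 then x else y) (Suc j)))"
      by simp
  qed (use x y in auto)
  also have "\<dots> < top"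
    using p_fun_finite[OF x y, of \<theta> q] p_fun_finite[OF y x, of \<theta> q]
    by (simp add: P_fun_def ennreal_divide_eq_top_iff less_top[symmetric])
  finally have "Inf ?A < top" .
  then have "K_M X0 X1 1 x y / ?c \<le> enn2real (Inf ?A)"
    using enn2real_mono[OF lower] K_M_nonneg[of 1 X0 X1 x y] ne x y c by simp
  then show ?thesis
    using c by (simp add: delta_R_def field_simps)
qed

section \<open>Compactness by approximation\<close>

text \<open>Boundedness in \<open>X0\<close> is available for sequences in \<open>A\<close> only, so
  density is used to move a sequence there. The Lipschitz bound keeps the images close, and
  convergence passes back.\<close>

lemma compact_operator_dense_approx:
  assumes dense: "mtopology_of R closure_of A = mspace R"
    and A: "A \<subseteq> mspace X0"
    and Lip: "Lipschitz_continuous_map R F T" and comp: "compact_operator X0 F T"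
    and bdd: "\<And>\<sigma> :: nat \<Rightarrow> 'a. range \<sigma> \<subseteq> A \<Longrightarrow> mbounded_of R (range \<sigma>) \<Longrightarrow> mbounded_of X0 (range \<sigma>)"
  shows "compact_operator R F T"
proof -
  obtain L where L: "L > 0" "T \<in> mspace R \<rightarrow> mspace F"
    "\<And>x y. x \<in> mspace R \<Longrightarrow> y \<in> mspace R \<Longrightarrow> mdist F (T x) (T y) \<le> L * mdist R x y"
    using Lip unfolding Lipschitz_continuous_map_pos by blast
  interpret R: Metric_space "mspace R" "mdist R"
    by simp
  interpret F: Metric_space "mspace F" "mdist F"
    by simp
  have "\<exists>r l. strict_mono (r :: nat \<Rightarrow> nat) \<and> limitin (mtopology_of F) (T \<circ> \<sigma> \<circ> r) l sequentially"
    if \<sigma>: "range \<sigma> \<subseteq> mspace R" and b: "mbounded_of R (range \<sigma>)" for \<sigma> :: "nat \<Rightarrow> 'a"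
  proof -
    \<comment> \<open>The tolerance is at most 1, which preserves boundedness, and tends to 0, which
      later identifies the limits.\<close>
    have "\<exists>y. y \<in> A \<and> y \<in> mspace R \<and> mdist R (\<sigma> n) y < inverse (Suc n)" for n
    proof -
      have "\<sigma> n \<in> R.mtopology closure_of A"
        using \<sigma> dense by (auto simp: mtopology_of_def)
      then show ?thesis
        unfolding R.metric_closure_of by (auto dest!: spec[of _ "inverse (Suc n)"])
    qed
    then obtain \<tau> where \<tau>: "\<And>n. \<tau> n \<in> A" "\<And>n. \<tau> n \<in> mspace R" "\<And>n. mdist R (\<sigma> n) (\<tau> n) < inverse (Suc n)"
      by metis
    have mem: "\<sigma> n \<in> mspace R" "\<tau> n \<in> mspace R" for n
      using \<sigma> \<tau>(2) by auto
    obtain B where B: "\<And>m n. mdist R (\<sigma> m) (\<sigma> n) \<le> B"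
      using b unfolding R.mbounded_alt by blast
    \<comment> \<open>The summand 2 pays for one perturbation of size at most 1 at each end.\<close>
    have "mdist R (\<tau> m) (\<tau> n) \<le> B + 2" for m n
    proof -
      have "mdist R (\<tau> m) (\<tau> n) \<le> mdist R (\<tau> m) (\<sigma> m) + mdist R (\<sigma> m) (\<tau> n)"
        "mdist R (\<sigma> m) (\<tau> n) \<le> mdist R (\<sigma> m) (\<sigma> n) + mdist R (\<sigma> n) (\<tau> n)"
        by (intro mdist_triangle mem)+
      moreover have "mdist R (\<sigma> k) (\<tau> k) \<le> 1" for k
        using \<tau>(3)[of k] by (smt (verit) inverse_le_1_iff of_nat_0_le_iff of_nat_Suc)
      ultimately show ?thesis
        using B[of m n] by (smt (verit) mdist_commute)
    qed
    then have "mbounded_of R (range \<tau>)"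
      using mem(2) unfolding R.mbounded_alt by blast
    moreover have "range \<tau> \<subseteq> A"
      using \<tau>(1) by auto
    ultimately have "mbounded_of X0 (range \<tau>)" "range \<tau> \<subseteq> mspace X0"
      using bdd A by auto
    then obtain r l where r: "strict_mono (r :: nat \<Rightarrow> nat)"
      and lim: "limitin (mtopology_of F) (T \<circ> \<tau> \<circ> r) l sequentially"
      using comp unfolding compact_operator_def by blast
    have l: "l \<in> mspace F" and lim0: "(\<lambda>n. mdist F (T (\<tau> (r n))) l) \<longlonglongrightarrow> 0"
      using lim unfolding mtopology_of_def F.limitin_metric_dist_null by (auto simp: o_def)
    \<comment> \<open>Along the subsequence the two images differ by at most
      \<open>L * inverse (Suc (r n))\<close>, so they share the limit \<open>l\<close>.\<close>
    have "(\<lambda>n. mdist F (T (\<sigma> (r n))) l) \<longlonglongrightarrow> 0"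
    proof (rule tendsto_sandwich[where f = "\<lambda>_. 0"])
      show "(\<lambda>n. L * inverse (real (Suc (r n))) + mdist F (T (\<tau> (r n))) l) \<longlonglongrightarrow> 0"
        using tendsto_add[OF tendsto_mult_right_zero[OF LIMSEQ_subseq_LIMSEQ[OF LIMSEQ_inverse_real_of_nat r], of L] lim0]
        by (simp add: o_def)
      have "mdist F (T (\<sigma> (r n))) l \<le> L * inverse (Suc (r n)) + mdist F (T (\<tau> (r n))) l" for n
      proof -
        have "mdist F (T (\<sigma> (r n))) l \<le> mdist F (T (\<sigma> (r n))) (T (\<tau> (r n))) + mdist F (T (\<tau> (r n))) l"
          using mem L(2) l by (intro mdist_triangle) auto
        moreover have "mdist F (T (\<sigma> (r n))) (T (\<tau> (r n))) \<le> L * mdist R (\<sigma> (r n)) (\<tau> (r n))"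
          by (intro L mem)
        moreover have "L * mdist R (\<sigma> (r n)) (\<tau> (r n)) \<le> L * inverse (Suc (r n))"
          using L(1) \<tau>(3)[of "r n"] by (intro mult_left_mono) auto
        ultimately show ?thesis
          by linarith
      qed
      then show "\<forall>\<^sub>F n in sequentially. mdist F (T (\<sigma> (r n))) l
          \<le> L * inverse (real (Suc (r n))) + mdist F (T (\<tau> (r n))) l"
        by simp
    qed auto
    then have "limitin (mtopology_of F) (T \<circ> \<sigma> \<circ> r) l sequentially"
      unfolding mtopology_of_def F.limitin_metric_dist_null
      using l L(2) mem by (auto simp: o_def intro!: always_eventually)
    then show ?thesis
      using r by blast
  qed
  then show ?thesis
    using L(2) by (auto simp: compact_operator_def)
qed

section \<open>Lipschitz continuity and compactness on the R-interpolated space\<close>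

theorem corollary2:
  fixes X X0 X1 R :: "'a metric" and F :: "'b metric"
    and T :: "'a \<Rightarrow> 'b" and \<theta> :: real and q :: ereal
  assumes "compatible_pair X X0 X1"
    and "0 < \<theta>" "\<theta> < 1" and "1 \<le> q"
    and "mcomplete_of F"
    and "is_R_interpolated_space X0 X1 \<theta> q R"
    and "closed_operator X F T"
    and "compact_operator X0 F T" and "Lipschitz_continuous_map X0 F T"
    and "Lipschitz_continuous_map X1 F T"
    and "\<And>\<sigma> :: nat \<Rightarrow> 'a. range \<sigma> \<subseteq> mspace X0 \<inter> mspace X1 \<Longrightarrow>
           mbounded_of R (range \<sigma>) \<Longrightarrow> mbounded_of X0 (range \<sigma>)"
  shows "Lipschitz_continuous_map R F T \<and> compact_operator R F T"
proof -
  let ?A = "mspace X0 \<inter> mspace X1" and ?c = "splice_const \<theta>"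
  have ne: "?A \<noteq> {}"
    using assms(1) by (simp add: compatible_pair_def)
  have R: "mspace R = relative_completion ?A (delta_R X0 X1 \<theta> q) (mspace X0 \<union> mspace X1) (K_M X0 X1 1)"
    "mtopology_of R closure_of ?A = mspace R"
    "\<And>c. c > 0 \<Longrightarrow> (\<And>x y. x \<in> ?A \<Longrightarrow> y \<in> ?A \<Longrightarrow> K_M X0 X1 1 x y \<le> c * delta_R X0 X1 \<theta> q x y) \<Longrightarrow>
      (\<forall>x\<in>mspace R. \<forall>y\<in>mspace R. K_M X0 X1 1 x y \<le> c * mdist R x y)"
    using assms(6) by (auto simp: is_R_interpolated_space_def is_relative_completion_def)
  \<comment> \<open>The metric of the relative completion inherits every constant
    \<open>c > 0\<close> with \<open>K_M \<le> c * delta_R\<close> on the intersection;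
    \<open>splice_const \<theta>\<close> is one.\<close>
  have K_le: "K_M X0 X1 1 x y \<le> ?c * mdist R x y" if "x \<in> mspace R" "y \<in> mspace R" for x y
    using R(3)[OF splice_const_pos[OF assms(2,3)] K_M_le_delta_R[OF ne assms(2-4)]] that by blast
  have R_sub: "mspace R \<subseteq> mspace X0 \<union> mspace X1"
    using R(1) by (auto simp: relative_completion_def)
  obtain L where L: "L > 0" "\<And>x y. x \<in> mspace X0 \<union> mspace X1 \<Longrightarrow> y \<in> mspace X0 \<union> mspace X1 \<Longrightarrow>
      mdist F (T x) (T y) \<le> L * K_M X0 X1 1 x y"
    using Lipschitz_K_M[OF ne assms(9,10)] by blast
  have Lip: "Lipschitz_continuous_map R F T"
    unfolding Lipschitz_continuous_map_def
  proof (intro conjI exI ballI)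
    show "T \<in> mspace R \<rightarrow> mspace F"
      using R_sub assms(9,10) by (auto simp: Lipschitz_continuous_map_def)
    fix x y assume xy: "x \<in> mspace R" "y \<in> mspace R"
    have "mdist F (T x) (T y) \<le> L * K_M X0 X1 1 x y"
      using xy R_sub by (intro L) auto
    also have "\<dots> \<le> L * (?c * mdist R x y)"
      using L(1) K_le[OF xy] by simp
    finally show "mdist F (T x) (T y) \<le> L * ?c * mdist R x y"
      by (simp add: mult.assoc)
  qed
  have "compact_operator R F T"
    using assms(11) by (intro compact_operator_dense_approx[OF R(2) _ Lip assms(8)]) auto
  with Lip show ?thesis
    by blast
qed

end
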